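(* Let $X$ be a non-empty set and let $\mathscr{S}_X$ be a transformation semigroupoid on $X$. Then $\mathscr{S}_X$, with the partial operation $\circ$, is a semigroupoid.
   Context: A (partial) magma is a non-empty set $P$ with a partial binary operation $(x,y)\mapsto xy$, i.e. a function from some non-empty subset of $P\times P$ to $P$; "$xy$ is defined" means that $(x,y)$ lies in that subset. A compound expression is defined when all its successive products are: $(xy)z$ is defined iff $xy$ is defined and the product of $xy$ with $z$ is defined; similarly for $x(yz)$. A semigroupoid is a magma $P$ such that for all $x,y,z\in P$: if (a) $xy$ and $yz$ are both defined, or (b) $x(yz)$ is defined, or (c) $(xy)z$ is defined, then $(xy)z$ and $x(yz)$ are both defined and $(xy)z=x(yz)$. A transformation $f$ on $X$ consists of a subset $\mathrm{dom}(f)\subseteq X$, a rule assigning to each $x\in\mathrm{dom}(f)$ exactly one $f(x)\in X$, and a subset $\mathrm{cod}(f)\subseteq X$ with $\mathrm{im}(f)=\{f(x)\mid x\in\mathrm{dom}(f)\}\subseteq\mathrm{cod}(f)$. Two transformations are equal iff they have the same domain, codomain and values. It is non-empty if $\mathrm{dom}(f)\neq\emptyset$. A transformation magma on $X$ is a set $\mathscr{F}_X$ of non-empty transformations on $X$ that is a magma under the partial operation $\circ$, where $f\circ g$ is defined iff $\mathrm{dom}(f)\supseteq\mathrm{im}(g)$, and then $\mathrm{dom}(f\circ g)=\mathrm{dom}(g)$, $\mathrm{cod}(f\circ g)=\mathrm{cod}(f)$, $(f\circ g)(x)=f(g(x))$ for $x\in\mathrm{dom}(g)$ (in particular, $f\circ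 g\in\mathscr{F}_X$ whenever $f,g\in\mathscr{F}_X$ and $f\circ g$ is defined). A transformation semigroupoid on $X$ is a transformation magma $\mathscr{F}_X$ on $X$ such that for all $f,g\in\mathscr{F}_X$, if $\mathrm{dom}(f)\supseteq\mathrm{im}(g)$ then $\mathrm{dom}(f)=\mathrm{cod}(g)$. *)

theory Defs
  imports Main
begin

text \<open>A partial binary operation is a map on pairs: \<open>xy\<close> is defined iff
  \<open>(x, y) \<in> dom m\<close>, that is, iff \<open>m (x, y) \<noteq> None\<close>.\<close>

definition magma :: "'a set \<Rightarrow> ('a \<times> 'a \<rightharpoonup> 'a) \<Rightarrow> bool" where
  "magma P m \<longleftrightarrow> P \<noteq> {} \<and> dom m \<noteq> {} \<and> dom m \<subseteq> P \<times> P \<and> ran m \<subseteq> P"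

text \<open>The compound products are \<open>None\<close> exactly if one of the successive products is undefined.\<close>

definition prod_left :: "('a \<times> 'a \<rightharpoonup> 'a) \<Rightarrow> 'a \<Rightarrow> 'a \<Rightarrow> 'a \<Rightarrow> 'a option" where
  "prod_left m x y z = Option.bind (m (x, y)) (\<lambda>u. m (u, z))"

definition prod_right :: "('a \<times> 'a \<rightharpoonup> 'a) \<Rightarrow> 'a \<Rightarrow> 'a \<Rightarrow> 'a \<Rightarrow> 'a option" where
  "prod_right m x y z = Option.bind (m (y, z)) (\<lambda>v. m (x, v))"

definition semigroupoid :: "'a set \<Rightarrow> ('a \<times> 'a \<rightharpoonup> 'a) \<Rightarrow> bool" where
  "semigroupoid P m \<longleftrightarrow> magma P m \<and>
    (\<forall>x\<in>P. \<forall>y\<in>P. \<forall>z\<in>P.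
      (m (x, y) \<noteq> None \<and> m (y, z) \<noteq> None) \<or>
      prod_right m x y z \<noteq> None \<or>
      prod_left m x y z \<noteq> None
      \<longrightarrow>
      prod_left m x y z \<noteq> None \<and> prod_right m x y z \<noteq> None \<and>
      prod_left m x y z = prod_right m x y z)"

text \<open>The domain and the values of a transformation are both carried by a map, so that
  equality in the datatype is equality of domains, codomains and values.\<close>

datatype 'x transformation = Transformation (trule: "'x \<rightharpoonup> 'x") (tcod: "'x set")

definition tdom :: "'x transformation \<Rightarrow> 'x set" where
  "tdom f = dom (trule f)"

definition tapp :: "'x transformation \<Rightarrow> 'x \<Rightarrow> 'x" where
  "tapp f x = the (trule f x)"

definition tim :: "'x transformation \<Rightarrow> 'x set" where
  "tim f = {tapp f x | x. x \<in> tdom f}"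

definition transformation_on :: "'x set \<Rightarrow> 'x transformation \<Rightarrow> bool" where
  "transformation_on X f \<longleftrightarrow> tdom f \<subseteq> X \<and> tcod f \<subseteq> X \<and> tim f \<subseteq> tcod f"

lemma transformation_eq_iff:
  "f = g \<longleftrightarrow> tdom f = tdom g \<and> tcod f = tcod g \<and> (\<forall>x\<in>tdom f. tapp f x = tapp g x)"
proof
  assume r: "tdom f = tdom g \<and> tcod f = tcod g \<and> (\<forall>x\<in>tdom f. tapp f x = tapp g x)"
  have "trule f x = trule g x" for x
    using r by (cases "trule f x"; cases "trule g x") (force simp: tdom_def tapp_def dom_def)+
  then show "f = g"
    using r by (intro transformation.expand) auto
qed simp

text \<open>Only meaningful if \<open>tim g \<subseteq> tdom f\<close>; this condition is imposed in \<open>comp_on\<close>.\<close>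

definition tcomp :: "'x transformation \<Rightarrow> 'x transformation \<Rightarrow> 'x transformation" where
  "tcomp f g = Transformation (\<lambda>x. if x \<in> tdom g then Some (tapp f (tapp g x)) else None) (tcod f)"

lemma tcod_tcomp: "tcod (tcomp f g) = tcod f"
  by (simp add: tcomp_def)

lemma tdom_tcomp: "tdom (tcomp f g) = tdom g"
  by (auto simp: tcomp_def tdom_def dom_def)

lemma tapp_tcomp: "x \<in> tdom g \<Longrightarrow> tapp (tcomp f g) x = tapp f (tapp g x)"
  by (simp add: tcomp_def tapp_def)

definition comp_on ::
    "'x transformation set \<Rightarrow> ('x transformation \<times> 'x transformation \<rightharpoonup> 'x transformation)" where
  "comp_on F = (\<lambda>(f, g).
    if f \<in> F \<and> g \<in> F \<and> tim g \<subseteq> tdom f then Some (tcomp f g) else None)"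

text \<open>Closure of \<open>F\<close> under defined compositions is the condition \<open>ran m \<subseteq> P\<close> of \<open>magma\<close>.\<close>

definition transformation_magma :: "'x set \<Rightarrow> 'x transformation set \<Rightarrow> bool" where
  "transformation_magma X F \<longleftrightarrow>
    (\<forall>f\<in>F. transformation_on X f \<and> tdom f \<noteq> {}) \<and> magma F (comp_on F)"

definition transformation_semigroupoid :: "'x set \<Rightarrow> 'x transformation set \<Rightarrow> bool" where
  "transformation_semigroupoid X F \<longleftrightarrow> transformation_magma X F \<and>
    (\<forall>f\<in>F. \<forall>g\<in>F. tim g \<subseteq> tdom f \<longrightarrow> tdom f = tcod g)"

end

(* Since im g \<subseteq> cod g, the defining condition of a transformation semigroupoid makes f o g
   defined exactly when dom f = cod g. As dom (f o g) = dom g and cod (f o g) = cod f, each of the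
   conditions (a), (b), (c) then says dom f = cod g and dom g = cod h. *)

theory Submission
  imports Defs
begin

text \<open>\<open>tcomp\<close> is total, but \<open>tapp (tcomp f g)\<close> unfolds to the nested
  application only at points of \<open>tdom g\<close>; the assumption puts every value of
  \<open>h\<close> there.\<close>

lemma tcomp_assoc:
  assumes "tim h \<subseteq> tdom g"
  shows "tcomp (tcomp f g) h = tcomp f (tcomp g h)"
proof -
  have "tapp h x \<in> tdom g" if "x \<in> tdom h" for x
    using assms that by (auto simp: tim_def)
  then show ?thesis
    by (simp add: transformation_eq_iff tcod_tcomp tdom_tcomp tapp_tcomp)
qed

lemma comp_on_transformation_semigroupoid:
  assumes "transformation_semigroupoid X S"
  shows "comp_on S (f, g) =
    (if f \<in> S \<and> g \<in> S \<and> tdom f = tcod g then Some (tcomp f g) else None)"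
proof -
  have "tim g \<subseteq> tdom f \<longleftrightarrow> tdom f = tcod g" if "f \<in> S" "g \<in> S"
    using assms that
    unfolding transformation_semigroupoid_def transformation_magma_def transformation_on_def
    by metis
  then show ?thesis
    by (auto simp: comp_on_def)
qed

theorem theorem1:
  fixes X :: "'x set" and S :: "'x transformation set"
  assumes "X \<noteq> {}"
    and "transformation_semigroupoid X S"
  shows "semigroupoid S (comp_on S)"
proof -
  note comp = comp_on_transformation_semigroupoid[OF assms(2)]
  have magma: "magma S (comp_on S)" and im: "\<And>g. g \<in> S \<Longrightarrow> tim g \<subseteq> tcod g"
    using assms(2)
    unfolding transformation_semigroupoid_def transformation_magma_def transformation_on_def
    by blast+
  \<comment> \<open>\<open>comp_on S\<close> also tests membership in \<open>S\<close>, so an outer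
    product needs the inner composite to lie in \<open>S\<close>.\<close>
  have closed: "tcomp f g \<in> S" if "f \<in> S" "g \<in> S" "tdom f = tcod g" for f g
  proof -
    have "comp_on S (f, g) = Some (tcomp f g)"
      using that by (simp add: comp)
    then show ?thesis
      using magma by (auto simp: magma_def intro: ranI)
  qed
  \<comment> \<open>The outer product tests \<open>tdom (tcomp f g) = tcod h\<close> on the left and
    \<open>tdom f = tcod (tcomp g h)\<close> on the right; these reduce to the condition on the
    other pair.\<close>
  have left: "prod_left (comp_on S) f g h =
      (if tdom f = tcod g \<and> tdom g = tcod h then Some (tcomp (tcomp f g) h) else None)"
    and right: "prod_right (comp_on S) f g h =
      (if tdom f = tcod g \<and> tdom g = tcod h then Some (tcomp f (tcomp g h)) else None)"
    if "f \<in> S" "g \<in> S" "h \<in> S" for f g h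
    using that by (auto simp: prod_left_def prod_right_def comp closed tdom_tcomp tcod_tcomp)
  \<comment> \<open>Here \<open>tim h\<close> \<subseteq> \<open>tcod h\<close> =
    \<open>tdom g\<close>, as \<open>tcomp_assoc\<close> requires.\<close>
  have "tcomp (tcomp f g) h = tcomp f (tcomp g h)" if "h \<in> S" "tdom g = tcod h" for f g h
    using im that by (simp add: tcomp_assoc)
  then show ?thesis
    using magma by (auto simp: semigroupoid_def left right comp split: if_splits)
qed

end
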